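(* Let $M$ and $N$ be $n\times n$ substitution matrices that define telescope equivalent Bratteli diagrams. Then $M$ is invertible if and only if $N$ is invertible.
   Context: A symbolic substitution on a finite nonempty alphabet $\mathcal L=\{l_1,\dots,l_n\}$ is a map $\sigma:\mathcal L\to\mathcal L^*$ into the finite words over $\mathcal L$. Its substitution matrix is the $n\times n$ non-negative integer matrix whose $(i,j)$-entry is the number of occurrences of $l_j$ in $\sigma(l_i)$. Invertible means nonzero determinant (invertible over $\mathbb Q$). A (labelled) Bratteli diagram $(V,E,r,s,d)$ is an infinite directed graph with $V=\bigsqcup_{n\ge 0}V_n$, $E=\bigsqcup_{n\ge1}E_n$, all $V_n,E_n$ finite and nonempty, with $s(e)\in V_{n-1}$ and $r(e)\in V_n$ for $e\in E_n$; $s^{-1}(v)\ne\varnothing$ for all $v$, $r^{-1}(v)\neq\varnothing$ for all $v\notin V_0$; and a labelling $d:V\to\mathbb N$ with $d(v)=\sum_{r(e)=v}d(s(e))$ for $v\notin V_0$. The transition matrix from level $n-1$ to level $n$ has $(i,j)$-entry equal to the number of edges from the $i$-th vertex of $V_{n-1}$ to the $j$-th vertex of $V_n$. Two diagrams are isomorphic if there are bijections between their vertices and edges (level by level) preserving labels, range and source. Given a strictly increasing sequence $(m_n)_{n\ge0}$ of non-negative integers, the telescoping of the diagram has $V_n'=V_{m_n}$, $E_n'$ the set of paths from $V_{m_{n-1}}$ to $V_{m_n}$, with the induced range and source and restricted labelling; microscoping is the inverse operation. Two diagrams are telescope equivalent if one is obtained from the other by finitely many telescopings, microscopings and isomorphisms.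 The Bratteli diagram defined by (associated to) an $n\times n$ substitution matrix $M$ has $n$ vertices at every level, all labels equal to $1$ at level $0$, and every transition matrix equal to $M$ (it is understood that $M$ has no zero row or column, so that this is a Bratteli diagram). *)

theory Defs
  imports "Jordan_Normal_Form.Determinant"
begin

text \<open>An alphabet is given by the list \<open>ls\<close> of its letters; the order of the list is the numbering
  of the letters that the substitution matrix refers to.\<close>

definition symbolic_substitution :: "'a list \<Rightarrow> ('a \<Rightarrow> 'a list) \<Rightarrow> bool" where
  "symbolic_substitution ls \<sigma> \<longleftrightarrow>
     distinct ls \<and> ls \<noteq> [] \<and> (\<forall>a\<in>set ls. \<sigma> a \<in> lists (set ls))"

definition substitution_matrix :: "'a list \<Rightarrow> ('a \<Rightarrow> 'a list) \<Rightarrow> nat mat" where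
  "substitution_matrix ls \<sigma> =
     mat (length ls) (length ls) (\<lambda>(i, j). count_list (\<sigma> (ls ! i)) (ls ! j))"

definition rationally_invertible :: "nat mat \<Rightarrow> bool" where
  "rationally_invertible M \<longleftrightarrow> square_mat M \<and> det (map_mat rat_of_nat M) \<noteq> 0"

record ('v, 'e) bratteli =
  verts :: "nat \<Rightarrow> 'v set"
  edges :: "nat \<Rightarrow> 'e set"
  src :: "'e \<Rightarrow> 'v"
  rng :: "'e \<Rightarrow> 'v"
  label :: "'v \<Rightarrow> nat"

text \<open>Edge levels start at 1: \<open>edges D (Suc k)\<close> goes from level \<open>k\<close> to level \<open>Suc k\<close>, and the
  unused \<open>edges D 0\<close> is required to be empty.\<close>

locale bratteli_diagram =
  fixes D :: "('v, 'e) bratteli"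
  assumes finite_verts: "finite (verts D k)"
    and verts_nonempty: "verts D k \<noteq> {}"
    and verts_disjoint: "k \<noteq> l \<Longrightarrow> verts D k \<inter> verts D l = {}"
    and edges_0: "edges D 0 = {}"
    and finite_edges: "finite (edges D (Suc k))"
    and edges_nonempty: "edges D (Suc k) \<noteq> {}"
    and edges_disjoint: "k \<noteq> l \<Longrightarrow> edges D k \<inter> edges D l = {}"
    and src_in: "e \<in> edges D (Suc k) \<Longrightarrow> src D e \<in> verts D k"
    and rng_in: "e \<in> edges D (Suc k) \<Longrightarrow> rng D e \<in> verts D (Suc k)"
    and src_surj: "v \<in> verts D k \<Longrightarrow> \<exists>e\<in>edges D (Suc k). src D e = v"
    and rng_surj: "v \<in> verts D (Suc k) \<Longrightarrow> \<exists>e\<in>edges D (Suc k). rng D e = v"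
    and label_sum: "v \<in> verts D (Suc k) \<Longrightarrow>
      label D v = (\<Sum>e\<in>{e \<in> edges D (Suc k). rng D e = v}. label D (src D e))"

definition isomorphic :: "('v, 'e) bratteli \<Rightarrow> ('w, 'f) bratteli \<Rightarrow> bool" where
  "isomorphic D D' \<longleftrightarrow> (\<exists>f g.
     (\<forall>k. bij_betw f (verts D k) (verts D' k)) \<and>
     (\<forall>k. bij_betw g (edges D k) (edges D' k)) \<and>
     (\<forall>k. \<forall>v\<in>verts D k. label D' (f v) = label D v) \<and>
     (\<forall>k. \<forall>e\<in>edges D k. src D' (g e) = f (src D e) \<and> rng D' (g e) = f (rng D e)))"

definition paths :: "('v, 'e) bratteli \<Rightarrow> nat \<Rightarrow> nat \<Rightarrow> 'e list set" where
  "paths D a b = {es. length es = b - a \<and>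
     (\<forall>i < b - a. es ! i \<in> edges D (Suc (a + i))) \<and>
     (\<forall>i. Suc i < b - a \<longrightarrow> rng D (es ! i) = src D (es ! Suc i))}"

definition telescope :: "(nat \<Rightarrow> nat) \<Rightarrow> ('v, 'e) bratteli \<Rightarrow> ('v, 'e list) bratteli" where
  "telescope m D =
     \<lparr> verts = (\<lambda>k. verts D (m k)),
       edges = (\<lambda>k. case k of 0 \<Rightarrow> {} | Suc j \<Rightarrow> paths D (m j) (m (Suc j))),
       src = (\<lambda>es. src D (hd es)),
       rng = (\<lambda>es. rng D (last es)),
       label = label D \<rparr>"

text \<open>The edges of \<open>telescope m D\<close> have another type than those of \<open>D\<close>, so a telescoping is taken up
  to isomorphism to stay within one type. As isomorphisms are themselves allowed steps, this does not
  change the equivalence relation below. Nor does the choice of the types \<open>'v\<close> and \<open>'e\<close>: a Bratteli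
  diagram is countable, and any types carrying one are infinite, so every Bratteli diagram has an
  isomorphic copy over them.\<close>

definition is_telescoping :: "('v, 'e) bratteli \<Rightarrow> ('w, 'f) bratteli \<Rightarrow> bool" where
  "is_telescoping D D' \<longleftrightarrow> (\<exists>m. strict_mono m \<and> isomorphic (telescope m D) D')"

inductive telescope_equivalent :: "('v, 'e) bratteli \<Rightarrow> ('v, 'e) bratteli \<Rightarrow> bool" where
  refl: "bratteli_diagram D \<Longrightarrow> telescope_equivalent D D"
| isomorphism: "\<lbrakk>telescope_equivalent D D1; bratteli_diagram D2; isomorphic D1 D2\<rbrakk>
    \<Longrightarrow> telescope_equivalent D D2"
| telescoping: "\<lbrakk>telescope_equivalent D D1; bratteli_diagram D2; is_telescoping D1 D2\<rbrakk>
    \<Longrightarrow> telescope_equivalent D D2"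
| microscoping: "\<lbrakk>telescope_equivalent D D1; bratteli_diagram D2; is_telescoping D2 D1\<rbrakk>
    \<Longrightarrow> telescope_equivalent D D2"

text \<open>Here \<open>v k i\<close> is the vertex with number \<open>i\<close> (counting from 0) at level \<open>k\<close>.\<close>

definition transition_matrix ::
    "('v, 'e) bratteli \<Rightarrow> (nat \<Rightarrow> nat \<Rightarrow> 'v) \<Rightarrow> nat \<Rightarrow> nat mat" where
  "transition_matrix D v k = mat (card (verts D k)) (card (verts D (Suc k)))
     (\<lambda>(i, j). card {e \<in> edges D (Suc k). src D e = v k i \<and> rng D e = v (Suc k) j})"

text \<open>The diagram of a matrix is determined up to isomorphism only, hence a predicate. It can hold only
  if \<open>M\<close> is square without zero rows and columns, by \<open>src_surj\<close> and \<open>rng_surj\<close>.\<close>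

definition bratteli_diagram_of :: "nat mat \<Rightarrow> ('v, 'e) bratteli \<Rightarrow> bool" where
  "bratteli_diagram_of M D \<longleftrightarrow> bratteli_diagram D \<and>
     (\<forall>u\<in>verts D 0. label D u = 1) \<and>
     (\<exists>v. (\<forall>k. bij_betw (v k) {..<dim_row M} (verts D k)) \<and>
          (\<forall>k. transition_matrix D v k = M))"

end

theory Submission
  imports Defs
begin

text \<open>
  Telescoping does not change the direct limit of the rational vector spaces
  \<open>\<rat>^(verts D k)\<close> along the transition matrices (the dimension group of the diagram, tensored with
  \<open>\<rat>\<close>), and isomorphisms do not change it either. For the diagram of an \<open>n \<times> n\<close> matrix \<open>M\<close> this limit
  has dimension \<open>n\<close> exactly if \<open>M\<close> is invertible: an invertible \<open>M\<close> makes every map of the direct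
  system bijective, while a singular \<open>M\<close> sends the \<open>n\<close>-dimensional space of one level
  to a space of smaller dimension in the next. So invertibility of \<open>M\<close> depends only on \<open>n\<close> and on
  the telescope equivalence class.

  The limit itself is never formed. One of its elements is represented by a rational function on the
  vertices that satisfies, from some level on, the summation rule of the labels of a diagram; two such
  functions represent the same element if they agree on some level, and hence on all later ones. What
  is carried along is the statement that the limit contains \<open>n\<close> linearly independent elements, that
  is, that there are \<open>n\<close> such functions which remain linearly independent on every level
  (\<open>has_independent_labellings\<close>). Along a telescoping these functions can be restricted to the
  remaining levels, and conversely extended to the omitted ones (\<open>labelling_telescope\<close>,
  \<open>labelling_from_telescope\<close>).
\<close>

section \<open>Rational labellings of the tail of a diagram\<close>

text \<open>The summation rule of \<open>label\<close>, from level \<open>a\<close> on, for rational values of any sign.\<close>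

definition tail_labelling :: "('v, 'e) bratteli \<Rightarrow> nat \<Rightarrow> ('v \<Rightarrow> rat) \<Rightarrow> bool" where
  "tail_labelling D a f \<longleftrightarrow> (\<forall>k\<ge>a. \<forall>w\<in>verts D (Suc k).
     f w = (\<Sum>e\<in>{e \<in> edges D (Suc k). rng D e = w}. f (src D e)))"

definition independent_on :: "nat \<Rightarrow> 'v set \<Rightarrow> (nat \<Rightarrow> 'v \<Rightarrow> rat) \<Rightarrow> bool" where
  "independent_on n V f \<longleftrightarrow>
     (\<forall>c. (\<forall>w\<in>V. (\<Sum>i<n. c i * f i w) = 0) \<longrightarrow> (\<forall>i<n. c i = 0))"

text \<open>This says that the dimension group of \<open>D\<close>, tensored with \<open>\<rat>\<close>, has dimension at least \<open>n\<close>: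
  a linear combination vanishes in the direct limit if and only if it vanishes on some level.\<close>

definition has_independent_labellings :: "nat \<Rightarrow> ('v, 'e) bratteli \<Rightarrow> bool" where
  "has_independent_labellings n D \<longleftrightarrow> (\<exists>a f. (\<forall>i<n. tail_labelling D a (f i)) \<and>
     (\<forall>b\<ge>a. independent_on n (verts D b) f))"

text \<open>The part of \<open>bratteli_diagram\<close> that makes level-by-level arguments possible. It passes to
  telescopings.\<close>

locale layered =
  fixes D :: "('v, 'e) bratteli"
  assumes layers_disjoint: "k \<noteq> l \<Longrightarrow> verts D k \<inter> verts D l = {}"
    and src_layer: "e \<in> edges D (Suc k) \<Longrightarrow> src D e \<in> verts D k"
    and rng_layer: "e \<in> edges D (Suc k) \<Longrightarrow> rng D e \<in> verts D (Suc k)"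

lemma layered_bratteli: "bratteli_diagram D \<Longrightarrow> layered D"
  by (simp add: bratteli_diagram_def layered_def)

lemma tail_labelling_mono: "tail_labelling D a f \<Longrightarrow> a \<le> b \<Longrightarrow> tail_labelling D b f"
  by (auto simp: tail_labelling_def)

lemma tail_labelling_combination:
  assumes "\<And>i. i < n \<Longrightarrow> tail_labelling D a (f i)"
  shows "tail_labelling D a (\<lambda>w. \<Sum>i<n. c i * f i w)"
  unfolding tail_labelling_def
proof (intro allI impI ballI)
  fix k w assume k: "a \<le> k" and w: "w \<in> verts D (Suc k)"
  let ?E = "{e \<in> edges D (Suc k). rng D e = w}"
  have "(\<Sum>i<n. c i * f i w) = (\<Sum>i<n. c i * (\<Sum>e\<in>?E. f i (src D e)))"
    using assms k w by (intro sum.cong) (auto simp: tail_labelling_def)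
  also have "\<dots> = (\<Sum>e\<in>?E. \<Sum>i<n. c i * f i (src D e))"
    by (simp add: sum_distrib_left sum.swap[of _ "{..<n}"])
  finally show "(\<Sum>i<n. c i * f i w) = (\<Sum>e\<in>?E. \<Sum>i<n. c i * f i (src D e))" .
qed

text \<open>Vanishing on a level propagates to all later levels, so independence on a level implies
  independence on all earlier ones.\<close>

lemma tail_labelling_vanishes_later:
  assumes "layered D" "tail_labelling D a f" "a \<le> b" "\<forall>w\<in>verts D b. f w = 0" "b \<le> c"
  shows "\<forall>w\<in>verts D c. f w = 0"
  using assms(5)
proof (induction c rule: dec_induct)
  case base
  show ?case using assms(4) .
next
  case (step k)
  have "f w = 0" if w: "w \<in> verts D (Suc k)" for w
  proof -
    have "f w = (\<Sum>e\<in>{e \<in> edges D (Suc k). rng D e = w}. f (src D e))"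
      using assms(2,3) step.hyps w by (auto simp: tail_labelling_def)
    also have "\<dots> = 0"
      using step.IH layered.src_layer[OF assms(1)] by (intro sum.neutral) auto
    finally show ?thesis .
  qed
  then show ?case by blast
qed

lemma independent_on_earlier:
  assumes "layered D" "\<And>i. i < n \<Longrightarrow> tail_labelling D a (f i)"
    and "a \<le> b" "b \<le> c" "independent_on n (verts D c) f"
  shows "independent_on n (verts D b) f"
  unfolding independent_on_def
proof (intro allI impI)
  fix x i assume zero: "\<forall>w\<in>verts D b. (\<Sum>i<n. x i * f i w) = 0" and i: "i < n"
  have "\<forall>w\<in>verts D c. (\<Sum>i<n. x i * f i w) = 0"
    using tail_labelling_vanishes_later[OF assms(1) tail_labelling_combination assms(3) zero assms(4)]
      assms(2) by blast
  then show "x i = 0" using assms(5) i by (auto simp: independent_on_def)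
qed

lemma independent_on_cong:
  assumes "\<And>i w. i < n \<Longrightarrow> w \<in> V \<Longrightarrow> f i w = g i w"
  shows "independent_on n V f \<longleftrightarrow> independent_on n V g"
proof -
  have "(\<Sum>i<n. c i * f i w) = (\<Sum>i<n. c i * g i w)" if "w \<in> V" for c w
    using assms that by (intro sum.cong) auto
  then show ?thesis by (simp add: independent_on_def)
qed

text \<open>The summation rule determines a labelling, level by level, by arbitrary values on its first
  level. As the levels are disjoint, the functions obtained on them fit together.\<close>

lemma tail_labelling_extend:
  assumes "layered D"
  obtains f where "tail_labelling D a f" "\<And>w. w \<in> verts D a \<Longrightarrow> f w = g w"
proof -
  define F where "F = rec_nat g (\<lambda>k h w. \<Sum>e\<in>{e \<in> edges D (Suc (a + k)). rng D e = w}. h (src D e))"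
  define f where "f w = F ((THE k. w \<in> verts D k) - a) w" for w
  have level: "f w = F (k - a) w" if "w \<in> verts D k" for k w
  proof -
    have "(THE k. w \<in> verts D k) = k"
      using that layered.layers_disjoint[OF assms] by (intro the_equality) blast+
    then show ?thesis by (simp add: f_def)
  qed
  have "tail_labelling D a f"
    unfolding tail_labelling_def
  proof (intro allI impI ballI)
    fix k w assume k: "a \<le> k" and w: "w \<in> verts D (Suc k)"
    have "f w = F (Suc (k - a)) w" using level[OF w] k by (simp add: Suc_diff_le)
    also have "\<dots> = (\<Sum>e\<in>{e \<in> edges D (Suc k). rng D e = w}. F (k - a) (src D e))"
      using k by (simp add: F_def)
    also have "\<dots> = (\<Sum>e\<in>{e \<in> edges D (Suc k). rng D e = w}. f (src D e))"
      using level[of _ k] layered.src_layer[OF assms, of _ k] by (intro sum.cong) auto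
    finally show "f w = (\<Sum>e\<in>{e \<in> edges D (Suc k). rng D e = w}. f (src D e))" .
  qed
  moreover have "f w = g w" if "w \<in> verts D a" for w
    using level[OF that] by (simp add: F_def)
  ultimately show thesis using that by blast
qed

section \<open>Isomorphisms\<close>

lemma isomorphism_transports_labellings:
  assumes D: "layered D"
    and \<phi>: "\<And>k. bij_betw \<phi> (verts D k) (verts D' k)"
    and g: "\<And>k. bij_betw g (edges D k) (edges D' k)"
    and ends: "\<And>k e. e \<in> edges D k \<Longrightarrow>
      src D' (g e) = \<phi> (src D e) \<and> rng D' (g e) = \<phi> (rng D e)"
    and ff': "\<And>k v. v \<in> verts D k \<Longrightarrow> f' (\<phi> v) = f v"
  shows "tail_labelling D' a f' \<longleftrightarrow> tail_labelling D a f"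
proof -
  have "(f' (\<phi> w) = (\<Sum>e\<in>{e \<in> edges D' (Suc k). rng D' e = \<phi> w}. f' (src D' e))) \<longleftrightarrow>
        (f w = (\<Sum>e\<in>{e \<in> edges D (Suc k). rng D e = w}. f (src D e)))"
    if w: "w \<in> verts D (Suc k)" for k w
  proof -
    have inj: "\<phi> (rng D e) = \<phi> w \<longleftrightarrow> rng D e = w" if "e \<in> edges D (Suc k)" for e
      using \<phi>[of "Suc k"] layered.rng_layer[OF D that] w
      by (auto simp: bij_betw_def inj_on_def)
    have "{e \<in> edges D' (Suc k). rng D' e = \<phi> w} = g ` {e \<in> edges D (Suc k). rng D e = w}"
      using ends[of _ "Suc k"] inj bij_betw_imp_surj_on[OF g[of "Suc k"], symmetric] by auto
    moreover have "inj_on g {e \<in> edges D (Suc k). rng D e = w}"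
      using g[of "Suc k"] by (auto simp: bij_betw_def inj_on_def)
    ultimately have "(\<Sum>e\<in>{e \<in> edges D' (Suc k). rng D' e = \<phi> w}. f' (src D' e)) =
        (\<Sum>e\<in>{e \<in> edges D (Suc k). rng D e = w}. f' (src D' (g e)))"
      by (simp add: sum.reindex)
    also have "\<dots> = (\<Sum>e\<in>{e \<in> edges D (Suc k). rng D e = w}. f (src D e))"
      using ends[of _ "Suc k"] ff'[of _ k] layered.src_layer[OF D] by (intro sum.cong) auto
    finally show ?thesis using ff'[OF w] by simp
  qed
  moreover have "verts D' (Suc k) = \<phi> ` verts D (Suc k)" for k
    using \<phi> by (simp add: bij_betw_def)
  ultimately show ?thesis by (simp add: tail_labelling_def)
qed

lemma has_independent_labellings_isomorphic:
  assumes D: "layered D" and D': "layered D'" and iso: "isomorphic D D'"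
  shows "has_independent_labellings n D \<longleftrightarrow> has_independent_labellings n D'"
proof -
  obtain \<phi> g where \<phi>: "\<And>k. bij_betw \<phi> (verts D k) (verts D' k)"
    and g: "\<And>k. bij_betw g (edges D k) (edges D' k)"
    and ends: "\<And>k e. e \<in> edges D k \<Longrightarrow>
      src D' (g e) = \<phi> (src D e) \<and> rng D' (g e) = \<phi> (rng D e)"
    using iso unfolding isomorphic_def by blast
  let ?V = "\<Union>k. verts D k"
  \<comment> \<open>As the levels of \<open>D'\<close> are disjoint, the level-wise inverses of \<open>\<phi>\<close> form one function, along
    which the labellings of \<open>D\<close> are carried to \<open>D'\<close>.\<close>
  have inj: "inj_on \<phi> ?V"
  proof (rule inj_onI)
    fix u w assume "u \<in> ?V" "w \<in> ?V" and eq: "\<phi> u = \<phi> w"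
    then obtain k l where kl: "u \<in> verts D k" "w \<in> verts D l" by auto
    then have "\<phi> u \<in> verts D' k" "\<phi> w \<in> verts D' l" using \<phi> by (auto simp: bij_betw_def)
    with eq have "k = l" using layered.layers_disjoint[OF D', of k l] by auto
    with kl eq show "u = w" using \<phi>[of k] by (auto simp: bij_betw_def inj_on_def)
  qed
  have key: "(\<forall>i<n. tail_labelling D' a (f' i)) \<and> (\<forall>b\<ge>a. independent_on n (verts D' b) f') \<longleftrightarrow>
      (\<forall>i<n. tail_labelling D a (f i)) \<and> (\<forall>b\<ge>a. independent_on n (verts D b) f)"
    if ff': "\<And>i k v. v \<in> verts D k \<Longrightarrow> f' i (\<phi> v) = f i v" for f f' a
  proof -
    have "tail_labelling D' a (f' i) \<longleftrightarrow> tail_labelling D a (f i)" for i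
      using isomorphism_transports_labellings[where \<phi> = \<phi> and g = g and f = "f i" and f' = "f' i",
        OF D \<phi> g ends ff'] .
    moreover have "independent_on n (verts D' b) f' \<longleftrightarrow> independent_on n (verts D b) f" for b
    proof -
      have "verts D' b = \<phi> ` verts D b" using \<phi> by (simp add: bij_betw_def)
      then show ?thesis using ff' by (simp add: independent_on_def)
    qed
    ultimately show ?thesis by simp
  qed
  show ?thesis
  proof
    assume "has_independent_labellings n D"
    then obtain a f where f: "(\<forall>i<n. tail_labelling D a (f i)) \<and>
        (\<forall>b\<ge>a. independent_on n (verts D b) f)"
      by (auto simp: has_independent_labellings_def)
    define f' where "f' i v = f i (inv_into ?V \<phi> v)" for i v
    have "f' i (\<phi> v) = f i v" if "v \<in> verts D k" for i k v
    proof -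
      have "v \<in> ?V" using that by blast
      then show ?thesis by (simp add: f'_def inv_into_f_f[OF inj])
    qed
    with f key[of f' f a] show "has_independent_labellings n D'"
      unfolding has_independent_labellings_def by blast
  next
    assume "has_independent_labellings n D'"
    then obtain a f' where f': "(\<forall>i<n. tail_labelling D' a (f' i)) \<and>
        (\<forall>b\<ge>a. independent_on n (verts D' b) f')"
      by (auto simp: has_independent_labellings_def)
    with key[of f' "\<lambda>i v. f' i (\<phi> v)" a, OF HOL.refl]
    have "(\<forall>i<n. tail_labelling D a (\<lambda>v. f' i (\<phi> v))) \<and>
        (\<forall>b\<ge>a. independent_on n (verts D b) (\<lambda>i v. f' i (\<phi> v)))" by (rule iffD1)
    then show "has_independent_labellings n D"
      unfolding has_independent_labellings_def by (intro exI)
  qed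
qed

section \<open>Paths and telescopings\<close>

lemma paths_single: "paths D a (Suc a) = (\<lambda>e. [e]) ` edges D (Suc a)"
proof -
  have "es \<in> paths D a (Suc a) \<longleftrightarrow> es \<in> (\<lambda>e. [e]) ` edges D (Suc a)" for es
    by (cases es) (auto simp: paths_def)
  then show ?thesis by blast
qed

lemma paths_snoc:
  assumes "a < b"
  shows "es @ [e] \<in> paths D a (Suc b) \<longleftrightarrow>
    es \<in> paths D a b \<and> e \<in> edges D (Suc b) \<and> rng D (last es) = src D e"
proof (cases "length es = b - a")
  case False
  with assms show ?thesis by (auto simp: paths_def)
next
  case len: True
  have S: "Suc b - a = Suc (b - a)" using assms by simp
  have edges: "(\<forall>i<Suc b - a. (es @ [e]) ! i \<in> edges D (Suc (a + i))) \<longleftrightarrow>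
      (\<forall>i<b - a. es ! i \<in> edges D (Suc (a + i))) \<and> e \<in> edges D (Suc b)"
    using len assms unfolding S by (auto simp: nth_append less_Suc_eq)
  obtain l where l: "b - a = Suc l" using assms by (metis Suc_diff_Suc)
  have last: "last es = es ! l" using len l by (subst last_conv_nth) auto
  have glue: "(\<forall>i. Suc i < Suc b - a \<longrightarrow> rng D ((es @ [e]) ! i) = src D ((es @ [e]) ! Suc i)) \<longleftrightarrow>
      (\<forall>i. Suc i < b - a \<longrightarrow> rng D (es ! i) = src D (es ! Suc i)) \<and> rng D (last es) = src D e"
    using len unfolding S l last by (auto simp: nth_append less_Suc_eq)
  show ?thesis using len S edges glue by (auto simp: paths_def)
qed

lemma paths_nonempty_list: "a < b \<Longrightarrow> es \<in> paths D a b \<Longrightarrow> es \<noteq> []"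
  by (auto simp: paths_def)

lemma paths_Suc_ending:
  assumes "a < b"
  shows "{es \<in> paths D a (Suc b). rng D (last es) = w} =
    (\<lambda>(e, es). es @ [e]) ` (SIGMA e:{e \<in> edges D (Suc b). rng D e = w}.
      {es \<in> paths D a b. rng D (last es) = src D e})"
    (is "?L = ?R")
proof
  show "?L \<subseteq> ?R"
  proof
    fix es assume es: "es \<in> ?L"
    then have "es \<noteq> []" using paths_nonempty_list[of a "Suc b" es] assms by auto
    then have snoc: "es = butlast es @ [last es]" by simp
    with es have "butlast es @ [last es] \<in> paths D a (Suc b)" by simp
    then have "butlast es \<in> paths D a b" "last es \<in> edges D (Suc b)"
        "rng D (last (butlast es)) = src D (last es)"
      unfolding paths_snoc[OF assms] by auto
    with es show "es \<in> ?R" by (subst snoc, intro image_eqI[of _ _ "(last es, butlast es)"]) auto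
  qed
  show "?R \<subseteq> ?L" by (auto simp: paths_snoc[OF assms])
qed

lemma finite_paths:
  assumes "bratteli_diagram D" "a < b"
  shows "finite (paths D a b)"
proof -
  have fin: "finite (\<Union>k\<le>b. edges D k)"
    using bratteli_diagram.finite_edges[OF assms(1)] bratteli_diagram.edges_0[OF assms(1)]
    by (auto intro!: finite_UN_I) (metis finite.emptyI not0_implies_Suc)
  have "set es \<subseteq> (\<Union>k\<le>b. edges D k)" if "es \<in> paths D a b" for es
  proof
    fix e assume "e \<in> set es"
    then obtain i where "i < length es" "e = es ! i" by (auto simp: in_set_conv_nth)
    with that have "e \<in> edges D (Suc (a + i))" "Suc (a + i) \<le> b" by (auto simp: paths_def)
    then show "e \<in> (\<Union>k\<le>b. edges D k)" by blast
  qed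
  then have "paths D a b \<subseteq> {es. set es \<subseteq> (\<Union>k\<le>b. edges D k) \<and> length es = b - a}"
    by (auto simp: paths_def)
  then show ?thesis using finite_lists_length_eq[OF fin] finite_subset by blast
qed

text \<open>Iterating the summation rule expresses a label by the labels at any earlier level, each counted
  once for every path. This is the summation rule of the telescoped diagram.\<close>

lemma tail_labelling_path_sum:
  assumes D: "bratteli_diagram D" and f: "tail_labelling D a f"
    and "a < b" "w \<in> verts D b"
  shows "f w = (\<Sum>es\<in>{es \<in> paths D a b. rng D (last es) = w}. f (src D (hd es)))"
proof -
  have "Suc a \<le> b" using assms(3) by simp
  then show ?thesis using assms(4)
  proof (induction b arbitrary: w rule: dec_induct)
    case base
    have "{es \<in> paths D a (Suc a). rng D (last es) = w} =
        (\<lambda>e. [e]) ` {e \<in> edges D (Suc a). rng D e = w}"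
      by (auto simp: paths_single)
    then have "(\<Sum>es\<in>{es \<in> paths D a (Suc a). rng D (last es) = w}. f (src D (hd es))) =
        (\<Sum>e\<in>{e \<in> edges D (Suc a). rng D e = w}. f (src D e))"
      by (simp add: sum.reindex inj_on_def)
    then show ?case using f base by (simp add: tail_labelling_def)
  next
    case (step b)
    let ?E = "{e \<in> edges D (Suc b). rng D e = w}"
    let ?P = "\<lambda>v. {es \<in> paths D a b. rng D (last es) = v}"
    have ab: "a < b" using step.hyps by simp
    have "f w = (\<Sum>e\<in>?E. f (src D e))"
      using f ab step.prems by (simp add: tail_labelling_def)
    also have "\<dots> = (\<Sum>e\<in>?E. \<Sum>es\<in>?P (src D e). f (src D (hd es)))"
      using step.IH bratteli_diagram.src_in[OF D] by (intro sum.cong) auto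
    also have "\<dots> = (\<Sum>(e, es)\<in>(SIGMA e:?E. ?P (src D e)). f (src D (hd es)))"
      using bratteli_diagram.finite_edges[OF D] finite_paths[OF D ab]
      by (intro sum.Sigma) auto
    also have "\<dots> = (\<Sum>(e, es)\<in>(SIGMA e:?E. ?P (src D e)). f (src D (hd (es @ [e]))))"
      by (intro sum.cong) (auto simp: hd_append dest: paths_nonempty_list[OF ab])
    also have "\<dots> = (\<Sum>es\<in>(\<lambda>(e, es). es @ [e]) ` (SIGMA e:?E. ?P (src D e)). f (src D (hd es)))"
      by (subst sum.reindex) (auto simp: inj_on_def intro!: sum.cong)
    finally show ?case unfolding paths_Suc_ending[OF ab] .
  qed
qed

lemma paths_ends:
  assumes "bratteli_diagram D" "a < b" "es \<in> paths D a b"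
  shows "src D (hd es) \<in> verts D a" "rng D (last es) \<in> verts D b"
proof -
  have es: "length es = b - a" "\<And>i. i < b - a \<Longrightarrow> es ! i \<in> edges D (Suc (a + i))"
    using assms(3) by (auto simp: paths_def)
  have ne: "es \<noteq> []" using paths_nonempty_list assms(2,3) by blast
  have "hd es \<in> edges D (Suc a)"
    using es(2)[of 0] assms(2) ne by (simp add: hd_conv_nth)
  then show "src D (hd es) \<in> verts D a" by (rule bratteli_diagram.src_in[OF assms(1)])
  have "last es \<in> edges D (Suc (b - 1))"
    using es(2)[of "b - a - 1"] es(1) assms(2) ne by (simp add: last_conv_nth)
  from bratteli_diagram.rng_in[OF assms(1) this] show "rng D (last es) \<in> verts D b"
    using assms(2) by simp
qed

lemma layered_telescope:
  assumes D: "bratteli_diagram D" and m: "strict_mono m"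
  shows "layered (telescope m D)"
proof
  fix k l :: nat assume "k \<noteq> l"
  then have "m k \<noteq> m l" using strict_mono_eq[OF m] by simp
  then show "verts (telescope m D) k \<inter> verts (telescope m D) l = {}"
    using bratteli_diagram.verts_disjoint[OF D] by (simp add: telescope_def)
next
  fix es k assume "es \<in> edges (telescope m D) (Suc k)"
  moreover have "m k < m (Suc k)" using m by (simp add: strict_mono_Suc_iff)
  ultimately show "src (telescope m D) es \<in> verts (telescope m D) k"
      "rng (telescope m D) es \<in> verts (telescope m D) (Suc k)"
    using paths_ends[OF D] by (auto simp: telescope_def)
qed

lemma labelling_telescope:
  assumes D: "bratteli_diagram D" and m: "strict_mono m"
    and f: "tail_labelling D (m a) f"
  shows "tail_labelling (telescope m D) a f"
  unfolding tail_labelling_def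
proof (intro allI impI ballI)
  fix k w assume k: "a \<le> k" and w: "w \<in> verts (telescope m D) (Suc k)"
  have "m a \<le> m k" using k m by (simp add: strict_mono_less_eq)
  then have "tail_labelling D (m k) f" using f tail_labelling_mono by blast
  moreover have "m k < m (Suc k)" using m by (simp add: strict_mono_Suc_iff)
  moreover have "w \<in> verts D (m (Suc k))" using w by (simp add: telescope_def)
  ultimately show "f w = (\<Sum>es\<in>{es \<in> edges (telescope m D) (Suc k). rng (telescope m D) es = w}.
      f (src (telescope m D) es))"
    using tail_labelling_path_sum[OF D] by (simp add: telescope_def)
qed

lemma tail_labelling_unique:
  assumes "layered D" "tail_labelling D a f" "tail_labelling D a f'"
    and "\<And>w. w \<in> verts D a \<Longrightarrow> f w = f' w" and "a \<le> b" "w \<in> verts D b"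
  shows "f w = f' w"
  using assms(5,6)
proof (induction b arbitrary: w rule: dec_induct)
  case base
  then show ?case using assms(4) by simp
next
  case (step k)
  have "(\<Sum>e\<in>{e \<in> edges D (Suc k). rng D e = w}. f (src D e)) =
      (\<Sum>e\<in>{e \<in> edges D (Suc k). rng D e = w}. f' (src D e))"
    using step.IH layered.src_layer[OF assms(1)] by (intro sum.cong) auto
  then show ?case using assms(2,3) step.hyps step.prems by (simp add: tail_labelling_def)
qed

text \<open>A labelling of the telescoped diagram is extended to the omitted levels from its values on one
  level. By uniqueness it is recovered on all levels that are kept.\<close>

lemma labelling_from_telescope:
  assumes D: "bratteli_diagram D" and m: "strict_mono m"
    and f': "tail_labelling (telescope m D) a f'"
  obtains f where "tail_labelling D (m a) f"
    and "\<And>b w. a \<le> b \<Longrightarrow> w \<in> verts D (m b) \<Longrightarrow> f w = f' w"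
proof -
  obtain f where f: "tail_labelling D (m a) f" "\<And>w. w \<in> verts D (m a) \<Longrightarrow> f w = f' w"
    using tail_labelling_extend[OF layered_bratteli[OF D], of "m a" f'] by blast
  have "f w = f' w" if "a \<le> b" "w \<in> verts D (m b)" for b w
    using tail_labelling_unique[OF layered_telescope[OF D m] labelling_telescope[OF D m f(1)] f'
      _ that(1)] f(2) that(2) by (simp add: telescope_def)
  with f(1) show thesis using that by blast
qed

lemma has_independent_labellings_telescope:
  assumes D: "bratteli_diagram D" and m: "strict_mono m"
  shows "has_independent_labellings n D \<longleftrightarrow> has_independent_labellings n (telescope m D)"
proof
  assume "has_independent_labellings n D"
  then obtain a f where f: "\<forall>i<n. tail_labelling D a (f i)"
      "\<forall>b\<ge>a. independent_on n (verts D b) f"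
    by (auto simp: has_independent_labellings_def)
  have le: "a \<le> m b" if "a \<le> b" for b
    using that strict_mono_imp_increasing[OF m, of b] by simp
  have "\<forall>i<n. tail_labelling (telescope m D) a (f i)"
    using labelling_telescope[OF D m] tail_labelling_mono[OF _ le[OF order.refl]] f(1) by blast
  moreover have "\<forall>b\<ge>a. independent_on n (verts (telescope m D) b) f"
    using f(2) le by (simp add: telescope_def)
  ultimately show "has_independent_labellings n (telescope m D)"
    by (auto simp: has_independent_labellings_def)
next
  assume "has_independent_labellings n (telescope m D)"
  then obtain a f' where f': "\<forall>i<n. tail_labelling (telescope m D) a (f' i)"
      "\<forall>b\<ge>a. independent_on n (verts D (m b)) f'"
    by (auto simp: has_independent_labellings_def telescope_def)
  have "\<exists>f. tail_labelling D (m a) f \<and> (\<forall>b\<ge>a. \<forall>w\<in>verts D (m b). f w = f' i w)"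
    if "i < n" for i
    using labelling_from_telescope[OF D m, of a "f' i"] f'(1) that by metis
  then obtain f where f: "\<And>i. i < n \<Longrightarrow> tail_labelling D (m a) (f i)"
      "\<And>i b w. i < n \<Longrightarrow> a \<le> b \<Longrightarrow> w \<in> verts D (m b) \<Longrightarrow> f i w = f' i w"
    by metis
  \<comment> \<open>Independence is known on the kept levels only; these are cofinal.\<close>
  have "independent_on n (verts D b) f" if b: "m a \<le> b" for b
  proof (rule independent_on_earlier[OF layered_bratteli[OF D] f(1) b])
    show "b \<le> m (a + b)" using strict_mono_imp_increasing[OF m, of "a + b"] by simp
    have "independent_on n (verts D (m (a + b))) f'" using f'(2) by simp
    then show "independent_on n (verts D (m (a + b))) f"
      using independent_on_cong[of n "verts D (m (a + b))" f f'] f(2)[of _ "a + b"] by simp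
  qed
  with f(1) show "has_independent_labellings n D"
    unfolding has_independent_labellings_def by blast
qed

lemma has_independent_labellings_is_telescoping:
  assumes "bratteli_diagram D" "bratteli_diagram D'" "is_telescoping D D'"
  shows "has_independent_labellings n D \<longleftrightarrow> has_independent_labellings n D'"
proof -
  obtain m where m: "strict_mono m" "isomorphic (telescope m D) D'"
    using assms(3) by (auto simp: is_telescoping_def)
  show ?thesis
    using has_independent_labellings_telescope[OF assms(1) m(1)]
      has_independent_labellings_isomorphic[OF layered_telescope[OF assms(1) m(1)]
        layered_bratteli[OF assms(2)] m(2)]
    by blast
qed

lemma has_independent_labellings_telescope_equivalent:
  assumes "telescope_equivalent D D'" "bratteli_diagram D"
  shows "bratteli_diagram D' \<and>
    (has_independent_labellings n D \<longleftrightarrow> has_independent_labellings n D')"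
  using assms
  by induction
    (auto simp: has_independent_labellings_is_telescoping layered_bratteli
      has_independent_labellings_isomorphic)

section \<open>Diagrams of matrices\<close>

lemma singular_iff_left_kernel:
  fixes A :: "rat mat"
  assumes A: "A \<in> carrier_mat n n"
  shows "det A = 0 \<longleftrightarrow> (\<exists>x. (\<exists>i<n. x i \<noteq> 0) \<and> (\<forall>j<n. (\<Sum>i<n. x i * A $$ (i, j)) = 0))"
proof -
  have At: "A\<^sup>T \<in> carrier_mat n n" using A by simp
  have entry: "(A\<^sup>T *\<^sub>v v) $ j = (\<Sum>i<n. v $ i * A $$ (i, j))"
    if "v \<in> carrier_vec n" "j < n" for v j
    using A that by (auto simp: scalar_prod_def atLeast0LessThan mult.commute intro!: sum.cong)
  have ker: "A\<^sup>T *\<^sub>v v = 0\<^sub>v n \<longleftrightarrow> (\<forall>j<n. (\<Sum>i<n. v $ i * A $$ (i, j)) = 0)"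
    if "v \<in> carrier_vec n" for v
    using A entry[OF that] by (auto simp: vec_eq_iff)
  have "det A = 0 \<longleftrightarrow> (\<exists>v. v \<in> carrier_vec n \<and> v \<noteq> 0\<^sub>v n \<and> A\<^sup>T *\<^sub>v v = 0\<^sub>v n)"
    using det_0_iff_vec_prod_zero[OF At] det_transpose[OF A] by simp
  also have "\<dots> \<longleftrightarrow> (\<exists>x. (\<exists>i<n. x i \<noteq> 0) \<and> (\<forall>j<n. (\<Sum>i<n. x i * A $$ (i, j)) = 0))"
  proof
    assume "\<exists>v. v \<in> carrier_vec n \<and> v \<noteq> 0\<^sub>v n \<and> A\<^sup>T *\<^sub>v v = 0\<^sub>v n"
    then obtain v where v: "v \<in> carrier_vec n" "v \<noteq> 0\<^sub>v n" "A\<^sup>T *\<^sub>v v = 0\<^sub>v n" by blast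
    then have "\<exists>i<n. v $ i \<noteq> 0" by (auto simp: vec_eq_iff)
    with ker[OF v(1)] v(3) show "\<exists>x. (\<exists>i<n. x i \<noteq> 0) \<and> (\<forall>j<n. (\<Sum>i<n. x i * A $$ (i, j)) = 0)"
      by (intro exI[of _ "\<lambda>i. v $ i"]) simp
  next
    assume "\<exists>x. (\<exists>i<n. x i \<noteq> 0) \<and> (\<forall>j<n. (\<Sum>i<n. x i * A $$ (i, j)) = 0)"
    then obtain x where x: "\<exists>i<n. x i \<noteq> 0" "\<forall>j<n. (\<Sum>i<n. x i * A $$ (i, j)) = 0" by blast
    have "vec n x \<noteq> 0\<^sub>v n" using x(1) by (auto simp: vec_eq_iff)
    moreover have "A\<^sup>T *\<^sub>v vec n x = 0\<^sub>v n" using x(2) ker[of "vec n x"] by simp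
    ultimately show "\<exists>v. v \<in> carrier_vec n \<and> v \<noteq> 0\<^sub>v n \<and> A\<^sup>T *\<^sub>v v = 0\<^sub>v n"
      by (intro exI[of _ "vec n x"]) simp
  qed
  finally show ?thesis .
qed

text \<open>In the numbering of the vertices, the summation rule is multiplication of a row vector by
  \<open>M\<close>.\<close>

lemma incoming_sum_matrix:
  assumes D: "bratteli_diagram D" and M: "M \<in> carrier_mat n n"
    and v: "\<And>k. bij_betw (v k) {..<n} (verts D k)" and t: "transition_matrix D v k = M"
    and j: "j < n"
  shows "(\<Sum>e\<in>{e \<in> edges D (Suc k). rng D e = v (Suc k) j}. f (src D e)) =
    (\<Sum>i<n. f (v k i) * rat_of_nat (M $$ (i, j)))"
proof -
  let ?E = "{e \<in> edges D (Suc k). rng D e = v (Suc k) j}"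
  have card: "card (verts D l) = n" for l using bij_betw_same_card[OF v[of l]] by simp
  have "(\<Sum>e\<in>?E. f (src D e)) = (\<Sum>u\<in>verts D k. \<Sum>e\<in>{e \<in> ?E. src D e = u}. f (src D e))"
    using bratteli_diagram.finite_edges[OF D] bratteli_diagram.finite_verts[OF D]
      bratteli_diagram.src_in[OF D]
    by (intro sum.group[symmetric]) auto
  also have "\<dots> = (\<Sum>u\<in>verts D k. f u * rat_of_nat (card {e \<in> ?E. src D e = u}))"
    by (intro sum.cong) (auto simp: mult.commute)
  also have "\<dots> = (\<Sum>i<n. f (v k i) * rat_of_nat (card {e \<in> ?E. src D e = v k i}))"
    using sum.reindex_bij_betw[OF v[of k],
      of "\<lambda>u. f u * rat_of_nat (card {e \<in> ?E. src D e = u})"] by simp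
  also have "\<dots> = (\<Sum>i<n. f (v k i) * rat_of_nat (M $$ (i, j)))"
  proof (rule sum.cong, simp)
    fix i assume i: "i \<in> {..<n}"
    have "{e \<in> ?E. src D e = v k i} =
        {e \<in> edges D (Suc k). src D e = v k i \<and> rng D e = v (Suc k) j}" by auto
    moreover have "M $$ (i, j) = card {e \<in> edges D (Suc k). src D e = v k i \<and> rng D e = v (Suc k) j}"
      using i j unfolding t[symmetric] by (simp add: transition_matrix_def card)
    ultimately show "f (v k i) * rat_of_nat (card {e \<in> ?E. src D e = v k i}) =
        f (v k i) * rat_of_nat (M $$ (i, j))" by simp
  qed
  finally show ?thesis .
qed

lemma tail_labelling_step_matrix:
  assumes "bratteli_diagram D" "M \<in> carrier_mat n n" "tail_labelling D a f"
    and v: "\<And>k. bij_betw (v k) {..<n} (verts D k)" and "transition_matrix D v k = M"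
    and "a \<le> k" "j < n"
  shows "f (v (Suc k) j) = (\<Sum>i<n. f (v k i) * rat_of_nat (M $$ (i, j)))"
proof -
  have "v (Suc k) j \<in> verts D (Suc k)" using v[of "Suc k"] assms(7) by (auto simp: bij_betw_def)
  then show ?thesis
    using assms incoming_sum_matrix[OF assms(1,2) v assms(5,7), of f]
    by (simp add: tail_labelling_def)
qed

text \<open>On level \<open>Suc a\<close> the values of the \<open>n\<close> labellings form an \<open>n \<times> n\<close> matrix that is a multiple of
  \<open>M\<close>. If \<open>M\<close> is singular, so is this matrix, and the labellings are dependent on that
  level.\<close>

lemma independent_labellings_imp_invertible:
  assumes D: "bratteli_diagram D" and M: "M \<in> carrier_mat n n"
    and v: "\<And>k. bij_betw (v k) {..<n} (verts D k)" and t: "\<And>k. transition_matrix D v k = M"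
    and "has_independent_labellings n D"
  shows "det (map_mat rat_of_nat M) \<noteq> 0"
proof
  let ?M = "map_mat rat_of_nat M"
  assume "det ?M = 0"
  obtain a f where f: "\<And>i. i < n \<Longrightarrow> tail_labelling D a (f i)"
      "\<And>b. a \<le> b \<Longrightarrow> independent_on n (verts D b) f"
    using assms(5) by (auto simp: has_independent_labellings_def)
  \<comment> \<open>The rows of \<open>F * M\<close> are the vectors of values of the \<open>f i\<close> on level \<open>Suc a\<close>.\<close>
  define F where "F = mat n n (\<lambda>(i, j). f i (v a j))"
  have F: "F \<in> carrier_mat n n" and M': "?M \<in> carrier_mat n n" using M by (auto simp: F_def)
  have "det (F * ?M) = 0" using det_mult[OF F M'] \<open>det ?M = 0\<close> by simp
  then obtain c where c: "\<exists>i<n. c i \<noteq> 0" "\<forall>j<n. (\<Sum>i<n. c i * (F * ?M) $$ (i, j)) = 0"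
    using singular_iff_left_kernel[of "F * ?M" n] F M' by auto
  have FM: "(F * ?M) $$ (i, j) = f i (v (Suc a) j)" if "i < n" "j < n" for i j
    using that M tail_labelling_step_matrix[OF D M f(1) v t order.refl]
    by (simp add: F_def scalar_prod_def atLeast0LessThan)
  have "\<forall>w\<in>verts D (Suc a). (\<Sum>i<n. c i * f i w) = 0"
  proof
    fix w assume "w \<in> verts D (Suc a)"
    then obtain j where j: "j < n" "w = v (Suc a) j" using v[of "Suc a"] by (auto simp: bij_betw_def)
    then show "(\<Sum>i<n. c i * f i w) = 0" using c(2) FM by simp
  qed
  with f(2)[of "Suc a"] c(1) show False by (auto simp: independent_on_def)
qed

text \<open>For invertible \<open>M\<close> no information is lost from one level to the next, so the \<open>n\<close> unit vectors
  on level 0 stay independent on every later level.\<close>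

lemma invertible_imp_independent_labellings:
  assumes D: "bratteli_diagram D" and M: "M \<in> carrier_mat n n"
    and v: "\<And>k. bij_betw (v k) {..<n} (verts D k)" and t: "\<And>k. transition_matrix D v k = M"
    and det: "det (map_mat rat_of_nat M) \<noteq> 0"
  shows "has_independent_labellings n D"
proof -
  have inj: "\<forall>u\<in>verts D 0. h u = 0"
    if h: "tail_labelling D 0 h" and zero: "\<forall>w\<in>verts D b. h w = 0" for h b
    using zero
  proof (induction b)
    case (Suc k)
    have "h (v (Suc k) j) = 0" if "j < n" for j
      using Suc.prems v[of "Suc k"] that by (auto simp: bij_betw_def)
    then have "\<forall>j<n. (\<Sum>i<n. h (v k i) * map_mat rat_of_nat M $$ (i, j)) = 0"
      using tail_labelling_step_matrix[OF D M h v t] M by simp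
    then have "\<forall>i<n. h (v k i) = 0"
      using singular_iff_left_kernel[of "map_mat rat_of_nat M" n] det M by auto
    then have "\<forall>w\<in>verts D k. h w = 0"
      using bij_betw_imp_surj_on[OF v[of k], symmetric] by auto
    then show ?case by (rule Suc.IH)
  qed
  have "\<exists>f. tail_labelling D 0 f \<and> (\<forall>w\<in>verts D 0. f w = (if w = v 0 i then 1 else 0))" for i
    using tail_labelling_extend[OF layered_bratteli[OF D], of 0 "\<lambda>w. if w = v 0 i then 1 else 0"]
    by metis
  then obtain f where f: "\<And>i. tail_labelling D 0 (f i)"
      "\<And>i w. w \<in> verts D 0 \<Longrightarrow> f i w = (if w = v 0 i then 1 else 0)"
    by metis
  have "independent_on n (verts D b) f" for b
    unfolding independent_on_def
  proof (intro allI impI)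
    fix c j assume zero: "\<forall>w\<in>verts D b. (\<Sum>i<n. c i * f i w) = 0" and j: "j < n"
    have v0: "v 0 j \<in> verts D 0" using v[of 0] j by (auto simp: bij_betw_def)
    have "0 = (\<Sum>i<n. c i * f i (v 0 j))"
      using inj[OF tail_labelling_combination zero] f(1) v0 by simp
    also have "\<dots> = (\<Sum>i<n. if i = j then c i else 0)"
      using f(2)[OF v0] v[of 0] j by (intro sum.cong) (auto simp: bij_betw_def inj_on_def)
    also have "\<dots> = c j" using j by simp
    finally show "c j = 0" by simp
  qed
  with f(1) show ?thesis unfolding has_independent_labellings_def by blast
qed

lemma has_independent_labellings_iff_invertible:
  assumes "bratteli_diagram_of M D" and M: "M \<in> carrier_mat n n"
  shows "has_independent_labellings n D \<longleftrightarrow> rationally_invertible M"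
proof -
  from assms obtain v where D: "bratteli_diagram D"
    and v: "\<And>k. bij_betw (v k) {..<n} (verts D k)" and t: "\<And>k. transition_matrix D v k = M"
    by (auto simp: bratteli_diagram_of_def)
  show ?thesis
    using independent_labellings_imp_invertible[OF D M v t]
      invertible_imp_independent_labellings[OF D M v t] M
    by (auto simp: rationally_invertible_def)
qed

theorem proposition5p4:
  fixes n :: nat and M N :: "nat mat"
    and ls :: "'a list" and \<sigma> :: "'a \<Rightarrow> 'a list"
    and ks :: "'b list" and \<tau> :: "'b \<Rightarrow> 'b list"
    and D\<^sub>M D\<^sub>N :: "('v, 'e) bratteli"
  assumes "symbolic_substitution ls \<sigma>" and "M = substitution_matrix ls \<sigma>" and "M \<in> carrier_mat n n"
    and "symbolic_substitution ks \<tau>" and "N = substitution_matrix ks \<tau>" and "N \<in> carrier_mat n n"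
    and "bratteli_diagram_of M D\<^sub>M" and "bratteli_diagram_of N D\<^sub>N"
    and "telescope_equivalent D\<^sub>M D\<^sub>N"
  shows "rationally_invertible M \<longleftrightarrow> rationally_invertible N"
proof -
  have "bratteli_diagram D\<^sub>M" using assms(7) by (simp add: bratteli_diagram_of_def)
  then have "has_independent_labellings n D\<^sub>M \<longleftrightarrow> has_independent_labellings n D\<^sub>N"
    using has_independent_labellings_telescope_equivalent[OF assms(9)] by blast
  then show ?thesis
    using has_independent_labellings_iff_invertible[OF assms(7,3)]
      has_independent_labellings_iff_invertible[OF assms(8,6)] by blast
qed

end
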